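(* Let $X$ be a Banach two-sided $\mathbb{H}$-module, let $D(A)$ be a right $\mathbb{H}$-submodule of $X$ and let $A : D(A)\to X$ be a closed right linear operator. Then for all $p,q\in\rho_S(A)$, $$Q_p(A)-Q_q(A)=\big(\Delta_q(A)-\Delta_p(A)\big)Q_p(A)Q_q(A)=\big(\Delta_q(A)-\Delta_p(A)\big)Q_q(A)Q_p(A).$$
   Context: $\mathbb{H}$ is the real algebra of quaternions with conjugation $q\mapsto\overline{q}$, real part $\operatorname{Re}(q)$ and norm $|q|=\sqrt{q\overline{q}}$; $\mathbb{R}\subset\mathbb{H}$ is the set of real quaternions. A two-sided $\mathbb{H}$-module is an abelian group $X$ with left and right scalar multiplications by $\mathbb{H}$, biadditive and unital, with $p(qx)=(pq)x$, $(xp)q=x(pq)$, $p(xq)=(px)q$ for $p,q\in\mathbb{H}$, and $rx=xr$ for $r\in\mathbb{R}$. It is a Banach two-sided $\mathbb{H}$-module if it has a norm (definite, subadditive) with $\|qx\|=\|xq\|=|q|\|x\|$ for which it is complete. A right $\mathbb{H}$-submodule is a subgroup closed under right scalar multiplication. A map $A:D(A)\to X$ on a right $\mathbb{H}$-submodule is right linear if it is additive and $A(xq)=A(x)q$; it is closed if its graph is closed in $X\times X$. $D(A^2):=\{x\in D(A):Ax\in D(A)\}$, $A^2x:=A(Ax)$; juxtaposition of operators is composition. $\mathscr{L}^r(X)$ is the set of right linear $B:X\to X$ with $\|B\|:=\sup\{\|Bx\|:\|x\|\le1\}<\infty$. For $q\in\mathbb{H}$, $\Delta_q(A):=A^2-2\operatorname{Re}(q)A+|q|^2\mathrm{Id}:D(A^2)\to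 X$. $\rho_S(A):=\{q\in\mathbb{H}:\Delta_q(A)\text{ is bijective and }\Delta_q(A)^{-1}\in\mathscr{L}^r(X)\}$. For $q\in\rho_S(A)$: $Q_q(A):=\Delta_q(A)^{-1}$. *)

theory Defs
  imports "HOL-Analysis.Analysis"
begin

section \<open>Quaternions\<close>

datatype quat = Quat (qRe: real) (qI: real) (qJ: real) (qK: real)

lemma quat_eq_iff:
  "p = q \<longleftrightarrow> qRe p = qRe q \<and> qI p = qI q \<and> qJ p = qJ q \<and> qK p = qK q"
  by (auto intro: quat.expand)

instantiation quat :: real_algebra_1
begin

definition "0 = Quat 0 0 0 0"
definition "1 = Quat 1 0 0 0"
definition "p + q = Quat (qRe p + qRe q) (qI p + qI q) (qJ p + qJ q) (qK p + qK q)"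
definition "- q = Quat (- qRe q) (- qI q) (- qJ q) (- qK q)"
definition "p - q = Quat (qRe p - qRe q) (qI p - qI q) (qJ p - qJ q) (qK p - qK q)"
definition "scaleR r q = Quat (r * qRe q) (r * qI q) (r * qJ q) (r * qK q)"

text \<open>Hamilton's relations: \<open>i\<^sup>2 = j\<^sup>2 = k\<^sup>2 = -1\<close>, \<open>ij = k\<close>, \<open>jk = i\<close>, \<open>ki = j\<close>.\<close>

definition "p * q = Quat
  (qRe p * qRe q - qI p * qI q - qJ p * qJ q - qK p * qK q)
  (qRe p * qI q + qI p * qRe q + qJ p * qK q - qK p * qJ q)
  (qRe p * qJ q - qI p * qK q + qJ p * qRe q + qK p * qI q)
  (qRe p * qK q + qI p * qJ q - qJ p * qI q + qK p * qRe q)"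

instance
  by standard
    (simp_all add: quat_eq_iff zero_quat_def one_quat_def plus_quat_def uminus_quat_def
      minus_quat_def scaleR_quat_def times_quat_def algebra_simps)

end

lemma quat_sel [simp]:
  "qRe 0 = 0" "qI 0 = 0" "qJ 0 = 0" "qK 0 = 0"
  "qRe 1 = 1" "qI 1 = 0" "qJ 1 = 0" "qK 1 = 0"
  "qRe (p + q) = qRe p + qRe q" "qI (p + q) = qI p + qI q"
  "qJ (p + q) = qJ p + qJ q" "qK (p + q) = qK p + qK q"
  "qRe (- q) = - qRe q" "qI (- q) = - qI q" "qJ (- q) = - qJ q" "qK (- q) = - qK q"
  "qRe (p - q) = qRe p - qRe q" "qI (p - q) = qI p - qI q"
  "qJ (p - q) = qJ p - qJ q" "qK (p - q) = qK p - qK q"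
  "qRe (r *\<^sub>R q) = r * qRe q" "qI (r *\<^sub>R q) = r * qI q"
  "qJ (r *\<^sub>R q) = r * qJ q" "qK (r *\<^sub>R q) = r * qK q"
  by (simp_all add: zero_quat_def one_quat_def plus_quat_def uminus_quat_def
      minus_quat_def scaleR_quat_def)

lemma quat_of_real: "of_real r = Quat r 0 0 0"
  by (simp add: quat_eq_iff of_real_def)

definition qcnj :: "quat \<Rightarrow> quat" where
  "qcnj q = Quat (qRe q) (- qI q) (- qJ q) (- qK q)"

text \<open>\<open>q\<close> times its conjugate is a real quaternion; \<open>qRe\<close> only reads it as an element of \<open>real\<close>.\<close>

lemma quat_mult_qcnj:
  "q * qcnj q = of_real ((qRe q)\<^sup>2 + (qI q)\<^sup>2 + (qJ q)\<^sup>2 + (qK q)\<^sup>2)"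
  by (simp add: quat_eq_iff quat_of_real times_quat_def qcnj_def power2_eq_square)

lemma qRe_mult_qcnj_mult:
  "qRe ((p * q) * qcnj (p * q)) = qRe (p * qcnj p) * qRe (q * qcnj q)"
  unfolding quat_mult_qcnj quat_of_real quat.sel
  unfolding times_quat_def quat.sel by algebra

lemma sqrt_qRe_mult_qcnj:
  "sqrt (qRe (q * qcnj q)) = norm ((qRe q, qI q), (qJ q, qK q))"
  by (simp add: quat_mult_qcnj quat_of_real norm_prod_def add.assoc)

instantiation quat :: real_normed_algebra_1
begin

definition "norm q = sqrt (qRe (q * qcnj q))"
definition "sgn q = q /\<^sub>R norm q" for q :: quat
definition "dist p q = norm (p - q)" for p q :: quat
definition "uniformity = (INF e\<in>{0<..}. principal {(p :: quat, q). dist p q < e})"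
definition "open U \<longleftrightarrow> (\<forall>x\<in>U. \<forall>\<^sub>F (p, q) in uniformity. p = x \<longrightarrow> q \<in> U)" for U :: "quat set"

instance
proof
  fix p q :: quat and r :: real and U :: "quat set"
  show "dist p q = norm (p - q)" by (rule dist_quat_def)
  show "sgn q = q /\<^sub>R norm q" by (rule sgn_quat_def)
  show "uniformity = (INF e\<in>{0<..}. principal {(p :: quat, q). dist p q < e})"
    by (rule uniformity_quat_def)
  show "open U \<longleftrightarrow> (\<forall>x\<in>U. \<forall>\<^sub>F (p, q) in uniformity. p = x \<longrightarrow> q \<in> U)"
    by (rule open_quat_def)
  show "norm q = 0 \<longleftrightarrow> q = 0"
    unfolding norm_quat_def sqrt_qRe_mult_qcnj norm_eq_zero by (auto simp: quat_eq_iff zero_prod_def)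
  show "norm (p + q) \<le> norm p + norm q"
    unfolding norm_quat_def sqrt_qRe_mult_qcnj
    using norm_triangle_ineq[of "((qRe p, qI p), (qJ p, qK p))" "((qRe q, qI q), (qJ q, qK q))"]
    by simp
  show "norm (r *\<^sub>R q) = \<bar>r\<bar> * norm q"
    unfolding norm_quat_def sqrt_qRe_mult_qcnj
    using norm_scaleR[of r "((qRe q, qI q), (qJ q, qK q))"] by simp
  show "norm (p * q) \<le> norm p * norm q"
    by (simp add: norm_quat_def qRe_mult_qcnj_mult real_sqrt_mult)
  show "norm (1 :: quat) = 1"
    by (simp add: norm_quat_def quat_mult_qcnj quat_of_real)
qed

end

lemma norm_quat_mult: "norm (p * q) = norm p * norm q" for p q :: quat
  by (simp add: norm_quat_def qRe_mult_qcnj_mult real_sqrt_mult)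


section \<open>Two-sided quaternionic modules\<close>

class quat_bimodule = ab_group_add +
  fixes lscale :: "quat \<Rightarrow> 'a \<Rightarrow> 'a"  (infixr \<open>*l\<close> 75)
    and rscale :: "'a \<Rightarrow> quat \<Rightarrow> 'a"  (infixl \<open>*r\<close> 75)
  assumes lscale_add_left: "(p + q) *l x = p *l x + q *l x"
    and lscale_add_right: "q *l (x + y) = q *l x + q *l y"
    and rscale_add_left: "(x + y) *r q = x *r q + y *r q"
    and rscale_add_right: "x *r (p + q) = x *r p + x *r q"
    and lscale_one: "1 *l x = x"
    and rscale_one: "x *r 1 = x"
    and lscale_lscale: "p *l (q *l x) = (p * q) *l x"
    and rscale_rscale: "(x *r p) *r q = x *r (p * q)"
    and lscale_rscale: "p *l (x *r q) = (p *l x) *r q"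
    and real_central: "of_real r *l x = x *r of_real r"

text \<open>
  The class \<open>banach\<close> brings its own real scalar multiplication; the axiom
  \<open>scaleR_eq_lscale\<close> says that it is the one obtained by restricting the quaternionic
  multiplication to the real quaternions, so it is no additional structure.
\<close>

class quat_banach_bimodule = quat_bimodule + banach +
  assumes scaleR_eq_lscale: "r *\<^sub>R x = of_real r *l x"
    and norm_lscale: "norm (q *l x) = norm q * norm x"
    and norm_rscale: "norm (x *r q) = norm q * norm x"

text \<open>The quaternions are a Banach two-sided module over themselves.\<close>

instantiation quat :: quat_banach_bimodule
begin

definition "lscale p q = p * q" for p q :: quat
definition "rscale p q = p * q" for p q :: quat

instance
proof
  fix X :: "nat \<Rightarrow> quat"
  assume X: "Cauchy X"
  define f where "f q = ((qRe q, qI q), (qJ q, qK q))" for q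
  define g where "g v = Quat (fst (fst v)) (snd (fst v)) (fst (snd v)) (snd (snd v))"
    for v :: "(real \<times> real) \<times> (real \<times> real)"
  have dist_f: "dist (f p) (f q) = dist p q" for p q
    by (simp add: f_def dist_norm norm_quat_def sqrt_qRe_mult_qcnj)
  have fg: "f (g v) = v" for v
    by (simp add: f_def g_def)
  have "Cauchy (\<lambda>n. f (X n))"
    using X by (simp add: Cauchy_def dist_f)
  then obtain l where "(\<lambda>n. f (X n)) \<longlonglongrightarrow> l"
    using Cauchy_convergent_iff convergent_def by blast
  then have "X \<longlonglongrightarrow> g l"
    unfolding lim_sequentially using dist_f[of _ "g l"] by (simp add: fg)
  then show "convergent X"
    by (auto simp: convergent_def)
next
  fix r :: real and x :: quat
  show "of_real r *l x = x *r of_real r"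
    by (simp add: lscale_quat_def rscale_quat_def of_real_def)
qed (simp_all add: lscale_quat_def rscale_quat_def norm_quat_mult algebra_simps scaleR_conv_of_real)

end

definition right_submodule :: "'a::quat_bimodule set \<Rightarrow> bool" where
  "right_submodule S \<longleftrightarrow>
     0 \<in> S \<and> (\<forall>x\<in>S. \<forall>y\<in>S. x + y \<in> S) \<and> (\<forall>x\<in>S. - x \<in> S) \<and> (\<forall>x\<in>S. \<forall>q. x *r q \<in> S)"


section \<open>Partially defined operators\<close>

text \<open>
  An operator \<open>A : D(A) \<rightarrow> X\<close> is a map \<open>A :: 'a \<rightharpoonup> 'a\<close> with \<open>D(A) = dom A\<close>. Equality of such
  maps includes equality of the domains. Composition is \<open>map_comp\<close>, whose domain is
  \<open>{x \<in> dom B. B x \<in> dom A}\<close> for \<open>A \<circ>\<^sub>m B\<close>; sums and differences live on the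
  intersection of the domains. The identity operator is \<open>Some\<close>.
\<close>

definition right_linear :: "('a::quat_bimodule \<rightharpoonup> 'a) \<Rightarrow> bool" where
  "right_linear A \<longleftrightarrow> right_submodule (dom A) \<and>
     (\<forall>x\<in>dom A. \<forall>y\<in>dom A. the (A (x + y)) = the (A x) + the (A y)) \<and>
     (\<forall>x\<in>dom A. \<forall>q. the (A (x *r q)) = the (A x) *r q)"

definition closed_op :: "('a::topological_space \<rightharpoonup> 'a) \<Rightarrow> bool" where
  "closed_op A \<longleftrightarrow> closed (Map.graph A)"

definition op_add :: "('a \<rightharpoonup> 'a::plus) \<Rightarrow> ('a \<rightharpoonup> 'a) \<Rightarrow> ('a \<rightharpoonup> 'a)"  (infixl \<open>\<oplus>\<^sub>m\<close> 65) where
  "A \<oplus>\<^sub>m B = (\<lambda>x. if x \<in> dom A \<inter> dom B then Some (the (A x) + the (B x)) else None)"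

definition op_diff :: "('a \<rightharpoonup> 'a::minus) \<Rightarrow> ('a \<rightharpoonup> 'a) \<Rightarrow> ('a \<rightharpoonup> 'a)"  (infixl \<open>\<ominus>\<^sub>m\<close> 65) where
  "A \<ominus>\<^sub>m B = (\<lambda>x. if x \<in> dom A \<inter> dom B then Some (the (A x) - the (B x)) else None)"

definition op_scale :: "real \<Rightarrow> ('a \<rightharpoonup> 'a::quat_bimodule) \<Rightarrow> ('a \<rightharpoonup> 'a)"  (infixr \<open>\<odot>\<^sub>m\<close> 70) where
  "r \<odot>\<^sub>m A = (\<lambda>x. map_option (\<lambda>y. of_real r *l y) (A x))"

definition bijective_op :: "('a \<rightharpoonup> 'a) \<Rightarrow> bool" where
  "bijective_op A \<longleftrightarrow> bij_betw (\<lambda>x. the (A x)) (dom A) UNIV"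

definition inverse_op :: "('a \<rightharpoonup> 'a) \<Rightarrow> ('a \<rightharpoonup> 'a)" where
  "inverse_op A = (\<lambda>y. if y \<in> ran A then Some (THE x. A x = Some y) else None)"

definition bounded_right_linear :: "('a::quat_banach_bimodule \<rightharpoonup> 'a) set" where
  "bounded_right_linear =
     {B. dom B = UNIV \<and> right_linear B \<and> bdd_above {norm (the (B x)) |x. norm x \<le> 1}}"


section \<open>S-resolvent set and pseudo-resolvent\<close>

definition Delta_op :: "quat \<Rightarrow> ('a::quat_bimodule \<rightharpoonup> 'a) \<Rightarrow> ('a \<rightharpoonup> 'a)" where
  "Delta_op q A = (A \<circ>\<^sub>m A) \<ominus>\<^sub>m (2 * qRe q) \<odot>\<^sub>m A \<oplus>\<^sub>m (norm q)\<^sup>2 \<odot>\<^sub>m Some"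

lemma dom_Delta_op: "dom (Delta_op q A) = {x \<in> dom A. the (A x) \<in> dom A}"
  by (auto simp: Delta_op_def op_add_def op_diff_def op_scale_def map_comp_def dom_def
      split: option.splits if_splits)

lemma Delta_op_apply:
  assumes "x \<in> dom A" "the (A x) \<in> dom A"
  shows "Delta_op q A x =
    Some (the (A (the (A x))) - of_real (2 * qRe q) *l the (A x) + of_real ((norm q)\<^sup>2) *l x)"
  using assms by (auto simp: Delta_op_def op_add_def op_diff_def op_scale_def map_comp_def)

definition S_resolvent_set :: "('a::quat_banach_bimodule \<rightharpoonup> 'a) \<Rightarrow> quat set" where
  "S_resolvent_set A =
     {q. bijective_op (Delta_op q A) \<and> inverse_op (Delta_op q A) \<in> bounded_right_linear}"

text \<open>Only meaningful for \<open>q\<close> in the S-resolvent set of \<open>A\<close>.\<close>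

definition Q_op :: "quat \<Rightarrow> ('a::quat_bimodule \<rightharpoonup> 'a) \<Rightarrow> ('a \<rightharpoonup> 'a)" where
  "Q_op q A = inverse_op (Delta_op q A)"

end

theory Submission
  imports Defs
begin

text \<open>
  The operators \<open>\<Delta>\<^sub>p(A)\<close> and \<open>\<Delta>\<^sub>q(A)\<close> are polynomials in \<open>A\<close> with real coefficients. A right
  linear operator commutes with real scalars, so these polynomials commute wherever both
  products are defined. What is at stake is therefore the domains, and they take care of
  themselves: if \<open>z\<close> and \<open>\<Delta>\<^sub>p(A)z\<close> lie in \<open>D(A\<^sup>2)\<close>, then
  \<open>A\<^sup>2z = \<Delta>\<^sub>p(A)z + 2Re(p)Az - |p|\<^sup>2z\<close> lies in \<open>D(A)\<close>, hence \<open>Az\<close> lies in \<open>D(A\<^sup>2)\<close>, and then by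
  the same equation \<open>A\<^sup>2z\<close> lies in \<open>D(A\<^sup>2)\<close>; that is, \<open>z \<in> D(A\<^sup>4)\<close>. So if
  \<open>\<Delta>\<^sub>q(A)\<Delta>\<^sub>p(A)z\<close> is defined, then \<open>\<Delta>\<^sub>p(A)\<Delta>\<^sub>q(A)z\<close> is defined and has the same value
  (lemma \<open>Delta_op_commute\<close>).

  Given \<open>y\<close>, apply this to \<open>z = Q\<^sub>p(A)Q\<^sub>q(A)y\<close>. Then \<open>\<Delta>\<^sub>q(A)\<Delta>\<^sub>p(A)z = y\<close>, and so
  \<open>\<Delta>\<^sub>p(A)\<Delta>\<^sub>q(A)z = y\<close>. Inverting gives \<open>z = Q\<^sub>q(A)Q\<^sub>p(A)y\<close> and
  \<open>\<Delta>\<^sub>q(A)z = Q\<^sub>p(A)y\<close>, while \<open>\<Delta>\<^sub>p(A)z = Q\<^sub>q(A)y\<close> by the choice of \<open>z\<close>. Subtracting these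
  values at \<open>z\<close> gives both identities, as equalities of everywhere defined operators.
\<close>

lemma right_submodule_imp_subspace:
  fixes S :: "'a::quat_banach_bimodule set"
  assumes "right_submodule S"
  shows "subspace S"
  using assms
  by (auto simp: right_submodule_def subspace_def scaleR_eq_lscale real_central)

lemma right_linear_scaleR:
  fixes A :: "'a::quat_banach_bimodule \<rightharpoonup> 'a"
  assumes "right_linear A" "x \<in> dom A"
  shows "the (A (r *\<^sub>R x)) = r *\<^sub>R the (A x)"
  using assms by (simp add: right_linear_def scaleR_eq_lscale real_central)

lemma right_linear_add:
  assumes "right_linear A" "x \<in> dom A" "y \<in> dom A"
  shows "the (A (x + y)) = the (A x) + the (A y)"
  using assms by (simp add: right_linear_def)

lemma right_linear_diff:
  fixes A :: "'a::quat_banach_bimodule \<rightharpoonup> 'a"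
  assumes "right_linear A" "x \<in> dom A" "y \<in> dom A"
  shows "the (A (x - y)) = the (A x) - the (A y)"
proof -
  have "subspace (dom A)"
    using assms(1) right_submodule_imp_subspace by (auto simp: right_linear_def)
  then have "x - y \<in> dom A"
    using assms(2,3) subspace_diff by blast
  from right_linear_add[OF assms(1) this assms(3)] show ?thesis
    by simp
qed

lemma Delta_op_eq_Some_iff:
  fixes A :: "'a::quat_banach_bimodule \<rightharpoonup> 'a"
  shows "Delta_op q A x = Some y \<longleftrightarrow> x \<in> dom A \<and> the (A x) \<in> dom A \<and>
    y = the (A (the (A x))) - (2 * qRe q) *\<^sub>R the (A x) + (norm q)\<^sup>2 *\<^sub>R x"
proof (cases "x \<in> dom A \<and> the (A x) \<in> dom A")
  case True
  then have x: "x \<in> dom A" and Ax: "the (A x) \<in> dom A"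
    by blast+
  show ?thesis
    unfolding Delta_op_apply[OF x Ax] scaleR_eq_lscale using x Ax by blast
next
  case False
  then have "x \<notin> dom (Delta_op q A)"
    by (simp add: dom_Delta_op)
  with False show ?thesis
    by (auto simp: domIff)
qed

text \<open>
  The hypotheses only place \<open>z\<close> and \<open>\<Delta>\<^sub>p(A)z\<close> in \<open>D(A\<^sup>2)\<close>. Solving the definition of
  \<open>\<Delta>\<^sub>p(A)z\<close> for \<open>A\<^sup>2z\<close> raises the regularity of \<open>z\<close> one power of \<open>A\<close> at a time, up to
  \<open>D(A\<^sup>4)\<close>; there the two products are the same real polynomial in \<open>A\<close>.
\<close>

lemma Delta_op_commute:
  fixes A :: "'a::quat_banach_bimodule \<rightharpoonup> 'a"
  assumes lin: "right_linear A"
    and w: "Delta_op p A z = Some w"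
    and y: "Delta_op q A w = Some y"
  shows "\<exists>v. Delta_op q A z = Some v \<and> Delta_op p A v = Some y"
proof -
  define a where "a x = the (A x)" for x
  have sub: "subspace (dom A)"
    using lin right_submodule_imp_subspace by (auto simp: right_linear_def)
  note closure = subspace_add[OF sub] subspace_diff[OF sub] subspace_scale[OF sub]
  note linear = right_linear_add[OF lin, folded a_def] right_linear_diff[OF lin, folded a_def]
    right_linear_scaleR[OF lin, folded a_def]
  have z: "z \<in> dom A" "a z \<in> dom A"
    and w_eq: "w = a (a z) - (2 * qRe p) *\<^sub>R a z + (norm p)\<^sup>2 *\<^sub>R z"
    using w by (simp_all add: Delta_op_eq_Some_iff a_def)
  have wD: "w \<in> dom A" "a w \<in> dom A"
    and y_eq: "y = a (a w) - (2 * qRe q) *\<^sub>R a w + (norm q)\<^sup>2 *\<^sub>R w"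
    using y by (simp_all add: Delta_op_eq_Some_iff a_def)
  have a2z: "a (a z) = w + (2 * qRe p) *\<^sub>R a z - (norm p)\<^sup>2 *\<^sub>R z"
    by (simp add: w_eq)
  have z2: "a (a z) \<in> dom A"
    unfolding a2z by (intro closure wD z)
  have "a (a (a z)) = a w + (2 * qRe p) *\<^sub>R a (a z) - (norm p)\<^sup>2 *\<^sub>R a z"
    by (subst a2z) (simp add: linear closure wD z)
  then have z3: "a (a (a z)) \<in> dom A"
    by (simp add: closure wD z z2)
  note z_regular = z z2 z3
  define v where "v = a (a z) - (2 * qRe q) *\<^sub>R a z + (norm q)\<^sup>2 *\<^sub>R z"
  have aw: "a w = a (a (a z)) - (2 * qRe p) *\<^sub>R a (a z) + (norm p)\<^sup>2 *\<^sub>R a z"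
    unfolding w_eq by (simp add: linear closure z_regular)
  have av: "a v = a (a (a z)) - (2 * qRe q) *\<^sub>R a (a z) + (norm q)\<^sup>2 *\<^sub>R a z"
    unfolding v_def by (simp add: linear closure z_regular)
  have aaw: "a (a w) = a (a (a (a z))) - (2 * qRe p) *\<^sub>R a (a (a z)) + (norm p)\<^sup>2 *\<^sub>R a (a z)"
    unfolding aw by (simp add: linear closure z_regular)
  have aav: "a (a v) = a (a (a (a z))) - (2 * qRe q) *\<^sub>R a (a (a z)) + (norm q)\<^sup>2 *\<^sub>R a (a z)"
    unfolding av by (simp add: linear closure z_regular)
  have "v \<in> dom A"
    unfolding v_def by (intro closure z_regular)
  moreover have "a v \<in> dom A"
    unfolding av by (intro closure z_regular)
  moreover have "y = a (a v) - (2 * qRe p) *\<^sub>R a v + (norm p)\<^sup>2 *\<^sub>R v"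
    \<comment> \<open>Higher powers of \<open>A\<close> are replaced first: rewriting \<open>a w\<close> inside \<open>a (a w)\<close> would block \<open>aaw\<close>.\<close>
    unfolding y_eq aaw aav unfolding aw av unfolding w_eq v_def
    by (simp add: algebra_simps)
  ultimately have "Delta_op p A v = Some y"
    by (simp add: Delta_op_eq_Some_iff a_def)
  moreover have "Delta_op q A z = Some v"
    using z by (simp add: Delta_op_eq_Some_iff a_def v_def)
  ultimately show ?thesis
    by blast
qed

lemma inverse_op_eq_Some_iff:
  assumes "bijective_op B"
  shows "inverse_op B y = Some x \<longleftrightarrow> B x = Some y"
proof -
  have inj: "u = x" if "B u = Some y" "B x = Some y" for u x
    using assms that by (auto simp: bijective_op_def bij_betw_def inj_on_def dom_def)
  have "y \<in> (\<lambda>x. the (B x)) ` dom B"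
    using assms by (simp add: bijective_op_def bij_betw_def)
  then obtain u where u: "B u = Some y"
    by auto
  then have "(THE x. B x = Some y) = u"
    using inj by blast
  with u have "inverse_op B y = Some u"
    by (auto simp: inverse_op_def ran_def)
  with u inj show ?thesis
    by auto
qed

lemma Q_op_eq_Some_iff:
  assumes "q \<in> S_resolvent_set A"
  shows "Q_op q A y = Some x \<longleftrightarrow> Delta_op q A x = Some y"
  using assms by (simp add: Q_op_def S_resolvent_set_def inverse_op_eq_Some_iff)

lemma Q_op_total:
  assumes "q \<in> S_resolvent_set A"
  obtains x where "Q_op q A y = Some x"
proof -
  have "dom (Q_op q A) = UNIV"
    using assms by (simp add: Q_op_def S_resolvent_set_def bounded_right_linear_def)
  then show thesis
    using that by blast
qed

theorem proposition3p1:
  fixes A :: "'a::quat_banach_bimodule \<rightharpoonup> 'a"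
  assumes "right_submodule (dom A)"
    and "right_linear A"
    and "closed_op A"
    and "p \<in> S_resolvent_set A"
    and "q \<in> S_resolvent_set A"
  shows "Q_op p A \<ominus>\<^sub>m Q_op q A
           = (Delta_op q A \<ominus>\<^sub>m Delta_op p A) \<circ>\<^sub>m Q_op p A \<circ>\<^sub>m Q_op q A
       \<and> (Delta_op q A \<ominus>\<^sub>m Delta_op p A) \<circ>\<^sub>m Q_op p A \<circ>\<^sub>m Q_op q A
           = (Delta_op q A \<ominus>\<^sub>m Delta_op p A) \<circ>\<^sub>m Q_op q A \<circ>\<^sub>m Q_op p A"
proof -
  note Q_iff = Q_op_eq_Some_iff[OF assms(4)] Q_op_eq_Some_iff[OF assms(5)]
  have pointwise:
    "(Q_op p A \<ominus>\<^sub>m Q_op q A) y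
       = ((Delta_op q A \<ominus>\<^sub>m Delta_op p A) \<circ>\<^sub>m Q_op p A \<circ>\<^sub>m Q_op q A) y
     \<and> ((Delta_op q A \<ominus>\<^sub>m Delta_op p A) \<circ>\<^sub>m Q_op p A \<circ>\<^sub>m Q_op q A) y
       = ((Delta_op q A \<ominus>\<^sub>m Delta_op p A) \<circ>\<^sub>m Q_op q A \<circ>\<^sub>m Q_op p A) y" for y
  proof -
    obtain w where w: "Q_op q A y = Some w"
      using Q_op_total[OF assms(5)] .
    obtain z where z: "Q_op p A w = Some z"
      using Q_op_total[OF assms(4)] .
    have Dw: "Delta_op q A w = Some y" and Dz: "Delta_op p A z = Some w"
      using w z by (simp_all add: Q_iff)
    obtain v where Dz': "Delta_op q A z = Some v" and Dv: "Delta_op p A v = Some y"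
      using Delta_op_commute[OF assms(2) Dz Dw] by blast
    have v: "Q_op p A y = Some v" and z': "Q_op q A v = Some z"
      using Dv Dz' by (simp_all add: Q_iff)
    have diff: "(Delta_op q A \<ominus>\<^sub>m Delta_op p A) z = Some (v - w)"
      using Dz Dz' by (simp add: op_diff_def dom_def)
    have "(Q_op p A \<ominus>\<^sub>m Q_op q A) y = Some (v - w)"
      using v w by (simp add: op_diff_def dom_def)
    with diff v w z z' show ?thesis
      by (simp add: map_comp_def)
  qed
  then show ?thesis
    by (auto simp only: fun_eq_iff)
qed

end
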